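(* Let $T=\mathbb R_+=(0,\infty)$, let $\mu$ be Lebesgue measure on $T$, and let $\nu$ be Lebesgue measure, $\nu(A)=\int_A dp$, on $[a,b]$. Then the Boyd indices of the Integral Grand Lebesgue Space $G^{(Q)}_{\mu,\nu;a,b}$ are $$\alpha\left(G^{(Q)}_{\mu,\nu;a,b}\right)=\frac1b,\qquad \beta\left(G^{(Q)}_{\mu,\nu;a,b}\right)=\frac1a .$$
   Context: Let $1\le a<b\le\infty$ (with $1/\infty=0$) and let $Q\ge1$ be a constant. For measurable $f:T\to\mathbb R$ put $|f|_p=\left(\int_T|f|^p\,d\mu\right)^{1/p}$. The Integral Grand Lebesgue Space $G^{(Q)}_{\mu,\nu;a,b}$ is the set of all measurable $f:T\to\mathbb R$ with finite norm $$\|f\|=\left[\int_{[a,b]}|f|_p^{Q}\,\nu(dp)\right]^{1/Q}.$$ For $s>0$ the dilation operator $\sigma_s$ is $\sigma_s[f](t)=f(t/s)$, $t>0$. For a rearrangement invariant space $Y$ over $\mathbb R_+$, with $\|\sigma_s\|_Y$ the operator norm of $\sigma_s:Y\to Y$, the Boyd indices are $$\beta(Y)=\lim_{s\to\infty}\frac{\log\|\sigma_s\|_Y}{\log s},\qquad \alpha(Y)=\lim_{s\to0+}\frac{\log\|\sigma_s\|_Y}{\log s}.$$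
   Formalization: The space is assumed nonzero, which holds for every b < ∞ and excludes exactly b = ∞; there, with Lebesgue ν, the space is {0}, so the dilation norms vanish and the Boyd indices are undefined. *)

theory Defs
  imports "HOL-Analysis.Analysis"
begin

text \<open>
  Real powers and logarithms with extended values. \<open>epowr\<close> is only used with a positive
  exponent, where \<open>0\<close> goes to \<open>0\<close> and \<open>\<infinity>\<close> to \<open>\<infinity>\<close>; \<open>elog\<close> has \<open>elog 0 = -\<infinity>\<close>
  and \<open>elog \<infinity> = \<infinity>\<close>.
\<close>

definition epowr :: "ennreal \<Rightarrow> real \<Rightarrow> ennreal" where
  "epowr x r = (if x = \<infinity> then \<infinity> else ennreal (enn2real x powr r))"

definition elog :: "ennreal \<Rightarrow> ereal" where
  "elog x = (if x = 0 then -\<infinity> else if x = \<infinity> then \<infinity> else ereal (ln (enn2real x)))"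

definition Lp_norm :: "'a measure \<Rightarrow> real \<Rightarrow> ('a \<Rightarrow> real) \<Rightarrow> ennreal" where
  "Lp_norm \<mu> p f = epowr (\<integral>\<^sup>+ t. ennreal (\<bar>f t\<bar> powr p) \<partial>\<mu>) (1 / p)"

text \<open>
  The upper end \<open>b\<close> may be \<open>\<infinity>\<close>. The point \<open>p = \<infinity>\<close>, which is null for Lebesgue measure
  on \<open>[a, \<infinity>]\<close>, is left out of the range of integration.
\<close>

definition igl_norm ::
  "'a measure \<Rightarrow> real measure \<Rightarrow> real \<Rightarrow> real \<Rightarrow> ereal \<Rightarrow> ('a \<Rightarrow> real) \<Rightarrow> ennreal" where
  "igl_norm \<mu> \<nu> Q a b f =
     epowr (\<integral>\<^sup>+ p \<in> {p. a \<le> p \<and> ereal p \<le> b}. epowr (Lp_norm \<mu> p f) Q \<partial>\<nu>) (1 / Q)"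

definition igl_space ::
  "'a measure \<Rightarrow> real measure \<Rightarrow> real \<Rightarrow> real \<Rightarrow> ereal \<Rightarrow> ('a \<Rightarrow> real) set" where
  "igl_space \<mu> \<nu> Q a b = {f \<in> borel_measurable \<mu>. igl_norm \<mu> \<nu> Q a b f < \<infinity>}"

text \<open>
  Functions on \<open>(0, \<infinity>)\<close> are represented by functions on \<open>real\<close>; their values outside
  \<open>(0, \<infinity>)\<close> are ignored by \<open>lebesgue_on {0<..}\<close>.
\<close>

definition dilation :: "real \<Rightarrow> (real \<Rightarrow> real) \<Rightarrow> real \<Rightarrow> real" where
  "dilation s f = (\<lambda>t. f (t / s))"

text \<open>
  A function space is given by its carrier \<open>Y\<close> and its norm \<open>N\<close>.
\<close>

definition dilation_norm ::
  "(real \<Rightarrow> real) set \<Rightarrow> ((real \<Rightarrow> real) \<Rightarrow> ennreal) \<Rightarrow> real \<Rightarrow> ennreal" where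
  "dilation_norm Y N s = (SUP f \<in> {f \<in> Y. N f \<le> 1}. N (dilation s f))"

definition has_upper_Boyd_index ::
  "(real \<Rightarrow> real) set \<Rightarrow> ((real \<Rightarrow> real) \<Rightarrow> ennreal) \<Rightarrow> ereal \<Rightarrow> bool" where
  "has_upper_Boyd_index Y N \<beta> \<longleftrightarrow>
     ((\<lambda>s. elog (dilation_norm Y N s) / ereal (ln s)) \<longlongrightarrow> \<beta>) at_top"

definition has_lower_Boyd_index ::
  "(real \<Rightarrow> real) set \<Rightarrow> ((real \<Rightarrow> real) \<Rightarrow> ennreal) \<Rightarrow> ereal \<Rightarrow> bool" where
  "has_lower_Boyd_index Y N \<alpha> \<longleftrightarrow>
     ((\<lambda>s. elog (dilation_norm Y N s) / ereal (ln s)) \<longlongrightarrow> \<alpha>) (at_right 0)"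

text \<open>
  Boyd indices belong to rearrangement invariant spaces, which are nonzero by definition
  (they contain the indicators of sets of finite measure). For Lebesgue \<open>\<nu>\<close>
  this holds whenever \<open>b < \<infinity>\<close> (\<open>igl_nonzero_finite\<close>); for \<open>b = \<infinity>\<close> the space is zero
  (\<open>igl_zero_infinite\<close>), every \<open>dilation_norm\<close> is \<open>0\<close>, and no Boyd index is finite.
\<close>

definition nonzero_space :: "('a \<Rightarrow> real) set \<Rightarrow> (('a \<Rightarrow> real) \<Rightarrow> ennreal) \<Rightarrow> bool" where
  "nonzero_space Y N \<longleftrightarrow> (\<exists>f \<in> Y. N f \<noteq> 0)"

lemma epowr_mono: "0 \<le> r \<Longrightarrow> x \<le> y \<Longrightarrow> epowr x r \<le> epowr y r"
  by (auto simp: epowr_def top_unique intro!: ennreal_leI powr_mono2 enn2real_mono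
      simp flip: less_top)

lemma igl_nonzero_finite:
  assumes "1 \<le> Q" "1 \<le> a" "a < b"
  shows "nonzero_space (igl_space (lebesgue_on {0::real<..}) lebesgue Q a (ereal b))
           (igl_norm (lebesgue_on {0<..}) lebesgue Q a (ereal b))"
proof -
  let ?f = "indicator {0<..<1} :: real \<Rightarrow> real"
  have f: "(\<integral>\<^sup>+ t. ennreal (\<bar>?f t\<bar> powr p) \<partial>lebesgue_on {0<..}) = 1" for p
  proof -
    have "(\<integral>\<^sup>+ t. ennreal (\<bar>?f t\<bar> powr p) \<partial>lebesgue_on {0<..})
        = (\<integral>\<^sup>+ t. indicator {0<..<1::real} t \<partial>lebesgue)"
      by (subst nn_integral_restrict_space)
        (auto intro!: nn_integral_cong simp: indicator_def simp del: nn_integral_indicator)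
    also have "\<dots> = emeasure lebesgue {0<..<1::real}"
      by (rule nn_integral_indicator) simp
    finally show ?thesis by simp
  qed
  have set: "{p. a \<le> p \<and> ereal p \<le> ereal b} = {a..b}" by auto
  have "igl_norm (lebesgue_on {0<..}) lebesgue Q a (ereal b) ?f = ennreal ((b - a) powr (1 / Q))"
    using assms unfolding igl_norm_def Lp_norm_def f set
    by (simp add: epowr_def)
  moreover have "?f \<in> borel_measurable (lebesgue_on {0<..})"
    by (intro borel_measurable_indicator) (auto simp: sets_restrict_space_iff)
  ultimately have "?f \<in> igl_space (lebesgue_on {0<..}) lebesgue Q a (ereal b)"
    and "igl_norm (lebesgue_on {0<..}) lebesgue Q a (ereal b) ?f \<noteq> 0"
    using assms by (simp_all add: igl_space_def)
  then show ?thesis unfolding nonzero_space_def by blast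
qed

lemma igl_zero_infinite:
  assumes "1 \<le> Q" "1 \<le> a"
  shows "\<not> nonzero_space (igl_space (lebesgue_on {0::real<..}) lebesgue Q a \<infinity>)
           (igl_norm (lebesgue_on {0<..}) lebesgue Q a \<infinity>)"
proof
  let ?M = "lebesgue_on {0<..} :: real measure"
  assume "nonzero_space (igl_space ?M lebesgue Q a \<infinity>) (igl_norm ?M lebesgue Q a \<infinity>)"
  then obtain f where f: "f \<in> borel_measurable ?M" "igl_norm ?M lebesgue Q a \<infinity> f < \<infinity>"
    "igl_norm ?M lebesgue Q a \<infinity> f \<noteq> 0"
    by (auto simp: nonzero_space_def igl_space_def)
  define E where "E n = {t \<in> space ?M. 1 / real (Suc n) \<le> \<bar>f t\<bar>}" for n
  have E [measurable]: "E n \<in> sets ?M" for n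
    unfolding E_def using f(1) by measurable
  have "\<exists>n. emeasure ?M (E n) \<noteq> 0"
  proof (rule ccontr)
    assume "\<not> ?thesis"
    then have "AE t in ?M. t \<notin> E n" for n
      by (intro AE_not_in) (auto simp: null_sets_def)
    then have "AE t in ?M. \<forall>n. t \<notin> E n" by (simp add: AE_all_countable)
    then have z: "AE t in ?M. f t = 0"
    proof (rule AE_mp, intro AE_I2 impI)
      fix t assume t: "t \<in> space ?M" "\<forall>n. t \<notin> E n"
      show "f t = 0"
      proof (rule ccontr)
        assume "f t \<noteq> 0"
        then obtain n where "inverse (real (Suc n)) < \<bar>f t\<bar>"
          using reals_Archimedean[of "\<bar>f t\<bar>"] by auto
        with t show False by (auto simp: E_def field_simps intro: less_imp_le)
      qed
    qed
    have "(\<integral>\<^sup>+ t. ennreal (\<bar>f t\<bar> powr p) \<partial>?M) = 0" for p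
    proof -
      have "(\<integral>\<^sup>+ t. ennreal (\<bar>f t\<bar> powr p) \<partial>?M) = (\<integral>\<^sup>+ t. 0 \<partial>?M)"
        by (intro nn_integral_cong_AE) (use z in eventually_elim, auto)
      then show ?thesis by simp
    qed
    then show False
      using f(3) assms by (simp add: igl_norm_def Lp_norm_def epowr_def)
  qed
  then obtain n where n: "emeasure ?M (E n) \<noteq> 0" by blast
  define c where "c = 1 / real (Suc n)"
  have c: "c > 0" by (simp add: c_def)
  obtain m where m: "0 < m" "m \<le> 1" "ennreal m \<le> emeasure ?M (E n)"
  proof
    let ?m = "enn2real (min 1 (emeasure ?M (E n)))"
    have fin: "min 1 (emeasure ?M (E n)) < \<infinity>"
      by (simp add: min_less_iff_disj)
    show "0 < ?m" using n fin by (auto simp: enn2real_positive_iff zero_less_iff_neq_zero)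
    show "?m \<le> 1" by (rule enn2real_leI) auto
    show "ennreal ?m \<le> emeasure ?M (E n)" using fin by simp
  qed
  have Lp: "ennreal (c * m) \<le> Lp_norm ?M p f" if p: "1 \<le> p" for p
  proof -
    have "ennreal (c powr p * m) \<le> ennreal (c powr p) * emeasure ?M (E n)"
      using m c by (simp add: ennreal_mult mult_left_mono)
    also have "\<dots> = (\<integral>\<^sup>+ t. ennreal (c powr p) * indicator (E n) t \<partial>?M)"
      by (simp add: nn_integral_cmult_indicator)
    also have "\<dots> \<le> (\<integral>\<^sup>+ t. ennreal (\<bar>f t\<bar> powr p) \<partial>?M)"
      using p c by (intro nn_integral_mono)
        (auto simp: indicator_def E_def c_def intro!: ennreal_leI powr_mono2)
    finally have "epowr (ennreal (c powr p * m)) (1 / p) \<le> Lp_norm ?M p f"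
      unfolding Lp_norm_def using p by (intro epowr_mono) auto
    moreover have "epowr (ennreal (c powr p * m)) (1 / p) = ennreal (c * m powr (1 / p))"
      using c m p by (simp add: epowr_def powr_mult powr_powr)
    moreover have "m powr 1 \<le> m powr (1 / p)"
      using m p by (intro powr_mono') auto
    ultimately show ?thesis
      using c m by (metis (no_types, lifting) ennreal_leI less_eq_real_def mult_left_mono
          order_trans powr_one)
  qed
  have "\<infinity> = (\<integral>\<^sup>+ p \<in> {a..}. ennreal ((c * m) powr Q) \<partial>lebesgue)"
  proof -
    have "ennreal (real k) \<le> emeasure lborel {a..}" for k
      using emeasure_mono[of "{a..a + real k}" "{a..}" lborel] by auto
    then have "emeasure lborel {a..} = \<infinity>"
      by (metis ennreal_of_nat_eq_real_of_nat ennreal_Ex_less_of_nat infinity_ennreal_def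
          less_top linorder_not_le)
    then show ?thesis
      using c m by (simp add: nn_integral_cmult_indicator ennreal_mult_eq_top_iff)
  qed
  also have "\<dots> \<le> (\<integral>\<^sup>+ p \<in> {p. a \<le> p \<and> ereal p \<le> \<infinity>}. epowr (Lp_norm ?M p f) Q \<partial>lebesgue)"
  proof (intro nn_integral_mono, goal_cases)
    case (1 p)
    have "ennreal ((c * m) powr Q) \<le> epowr (Lp_norm ?M p f) Q" if "a \<le> p"
      using epowr_mono[OF _ Lp, of Q p] assms that c m by (simp add: epowr_def)
    then show ?case
      by (auto simp: indicator_def)
  qed
  finally have "igl_norm ?M lebesgue Q a \<infinity> f = \<infinity>"
    by (simp add: igl_norm_def epowr_def top_unique)
  with f(2) show False by simp
qed

end

theory Submission
  imports Defs "HOL-Real_Asymp.Real_Asymp"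
begin

text \<open>
  The change of variables \<open>t = s u\<close> gives \<open>|\<sigma>\<^sub>s f|\<^sub>p = s\<^bsup>1/p\<^esup> |f|\<^sub>p\<close> for every \<open>p\<close>
  (\<open>Lp_norm_dilation\<close>), so the dilation acts on the function \<open>p \<mapsto> |f|\<^sub>p\<close>, which is all that the
  norm sees, as multiplication by \<open>s\<^bsup>1/p\<^esup>\<close>. Let \<open>b\<close> be finite, and write \<open>D s\<close> for the operator
  norm of \<open>\<sigma>\<^sub>s\<close>.

  From above, \<open>D s\<close> is at most the largest value of \<open>s\<^bsup>1/p\<^esup>\<close> on \<open>[a, b]\<close>
  (\<open>igl_dilation_norm_le\<close>): this is \<open>s\<^bsup>1/a\<^esup>\<close> for \<open>s \<ge> 1\<close> and \<open>s\<^bsup>1/b\<^esup>\<close> for \<open>s \<le> 1\<close>.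

  From below, a single test function serves for all \<open>s\<close>: a multiple \<open>f\<close> of the indicator of
  \<open>(0, 1)\<close>, for which \<open>|f|\<^sub>p\<close> is independent of \<open>p\<close>. Keeping only the exponents in a subinterval
  \<open>[p, q]\<close> of \<open>[a, b]\<close> loses the factor \<open>((q - p) / (b - a))\<^bsup>1/Q\<^esup>\<close> and bounds \<open>D s\<close> from
  below by the least value of \<open>s\<^bsup>1/r\<^esup>\<close> on \<open>[p, q]\<close>, times this factor (\<open>igl_dilation_norm_ge\<close>).
  The subinterval is placed at the end \<open>a\<close> for \<open>s \<rightarrow> \<infinity>\<close>, at the end \<open>b\<close> for \<open>s \<rightarrow> 0\<close>, and has
  length \<open>(b - a) / (1 + |ln s|)\<close>. The length tends to \<open>0\<close>, so the exponent tends to \<open>1/a\<close> or \<open>1/b\<close>;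
  yet it does so slowly enough that the logarithm of the lost factor is \<open>o(ln s)\<close>. Dividing
  logarithms by \<open>ln s\<close> squeezes \<open>ln (D s) / ln s\<close> between two functions with the same limit.

  For \<open>b = \<infinity>\<close> the norm takes only the values \<open>0\<close> and \<open>\<infinity>\<close> (\<open>igl_norm_infinite_dichotomy\<close>), so
  the space is never nonzero.
\<close>

section \<open>Extended powers\<close>

lemma epowr_cmult:
  assumes "0 < c"
  shows "epowr (ennreal c * x) r = ennreal (c powr r) * epowr x r"
  using assms
  by (cases x) (auto simp: epowr_def ennreal_mult_top ennreal_top_mult powr_mult
      enn2real_mult ennreal_mult simp flip: ennreal_mult)

lemma borel_measurable_epowr:
  assumes "f \<in> borel_measurable M" "r \<in> borel_measurable M"
  shows "(\<lambda>x. epowr (f x) (r x)) \<in> borel_measurable M"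
  using assms unfolding epowr_def by measurable

section \<open>Dilations multiply the p-norm by a power\<close>

abbreviation (input) halfline :: "real measure" where
  "halfline \<equiv> lebesgue_on {0<..}"

lemma nn_integral_halfline_scale:
  assumes g: "g \<in> borel_measurable halfline" and s: "0 < s"
  shows "(\<integral>\<^sup>+ t. g (t / s) \<partial>halfline) = ennreal s * (\<integral>\<^sup>+ t. g t \<partial>halfline)"
proof -
  let ?G = "\<lambda>t. g t * indicator {0<..} t"
  have G: "?G \<in> borel_measurable lebesgue"
    using g by (subst (asm) borel_measurable_restrict_space_iff_ennreal) auto
  have "(\<integral>\<^sup>+ t. ?G t \<partial>lebesgue) = ennreal (1 / s) * (\<integral>\<^sup>+ t. ?G (0 + 1 / s * t) \<partial>lebesgue)"
    using nn_integral_real_affine_lebesgue[OF G, of "1 / s" 0] s by simp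
  also have "(\<lambda>t. ?G (0 + 1 / s * t)) = (\<lambda>t. g (t / s) * indicator {0<..} t)"
    using s by (auto simp: fun_eq_iff indicator_def zero_less_divide_iff)
  finally have "ennreal s * (\<integral>\<^sup>+ t. ?G t \<partial>lebesgue)
      = ennreal (s * (1 / s)) * (\<integral>\<^sup>+ t. g (t / s) * indicator {0<..} t \<partial>lebesgue)"
    using s by (simp add: ennreal_mult mult.assoc del: nonzero_mult_div_cancel_left times_divide_eq_right)
  then show ?thesis
    using s by (simp add: nn_integral_restrict_space)
qed

lemma Lp_norm_dilation:
  assumes f: "f \<in> borel_measurable halfline" and s: "0 < s"
  shows "Lp_norm halfline p (dilation s f) = ennreal (s powr (1 / p)) * Lp_norm halfline p f"
proof -
  have "(\<integral>\<^sup>+ t. ennreal (\<bar>f (t / s)\<bar> powr p) \<partial>halfline)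
      = ennreal s * (\<integral>\<^sup>+ t. ennreal (\<bar>f t\<bar> powr p) \<partial>halfline)"
    by (rule nn_integral_halfline_scale[of "\<lambda>t. ennreal (\<bar>f t\<bar> powr p)", OF _ s]) (use f in measurable)
  then show ?thesis
    unfolding Lp_norm_def dilation_def using epowr_cmult[OF s] by simp
qed

lemma sigma_finite_halfline: "sigma_finite_measure halfline"
proof (rule sigma_finite_measure_restrict_space)
  show "sigma_finite_measure (lebesgue :: real measure)"
  proof
    show "\<exists>A :: real set set. countable A \<and> A \<subseteq> sets lebesgue \<and> \<Union>A = space lebesgue
        \<and> (\<forall>a\<in>A. emeasure lebesgue a \<noteq> \<infinity>)"
      using lborel.sigma_finite_countable by (fastforce intro: sets_completionI_sets)
  qed
qed simp

text \<open>
  This is Tonelli's theorem for \<open>|f t|\<^sup>p\<close> as a function of \<open>(p, t)\<close>. It allows constants to be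
  pulled out of the integral over \<open>p\<close>.
\<close>

lemma borel_measurable_Lp_norm:
  assumes f: "f \<in> borel_measurable halfline"
  shows "(\<lambda>p. Lp_norm halfline p f) \<in> borel_measurable lebesgue"
proof -
  interpret sigma_finite_measure halfline by (rule sigma_finite_halfline)
  have "(\<lambda>p. Lp_norm halfline p f) \<in> borel_measurable borel"
    unfolding Lp_norm_def
    by (intro borel_measurable_epowr borel_measurable_nn_integral) (use f in measurable)
  then show ?thesis by (simp add: measurable_completion)
qed

section \<open>Comparing Integral Grand Lebesgue norms\<close>

lemma igl_norm_dilation_le:
  assumes f: "f \<in> borel_measurable halfline" and s: "0 < s" and Q: "0 < Q" and M: "0 < M"
    and le: "\<And>p. a \<le> p \<Longrightarrow> ereal p \<le> b \<Longrightarrow> s powr (1 / p) \<le> M"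
  shows "igl_norm halfline lebesgue Q a b (dilation s f)
       \<le> ennreal M * igl_norm halfline lebesgue Q a b f"
proof -
  let ?I = "{p. a \<le> p \<and> ereal p \<le> b}"
  have I: "?I \<in> sets lebesgue"
    by simp
  have "(\<integral>\<^sup>+ p\<in>?I. epowr (Lp_norm halfline p (dilation s f)) Q \<partial>lebesgue)
      \<le> (\<integral>\<^sup>+ p. ennreal (M powr Q) * (epowr (Lp_norm halfline p f) Q * indicator ?I p) \<partial>lebesgue)"
  proof (intro nn_integral_mono, goal_cases)
    case (1 p)
    have "epowr (Lp_norm halfline p (dilation s f)) Q \<le> epowr (ennreal M * Lp_norm halfline p f) Q"
      if "p \<in> ?I"
      unfolding Lp_norm_dilation[OF f s]
      using that le Q by (intro epowr_mono mult_right_mono ennreal_leI) auto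
    then show ?case
      using epowr_cmult[OF M] by (auto simp: indicator_def)
  qed
  also have "\<dots> = ennreal (M powr Q) * (\<integral>\<^sup>+ p\<in>?I. epowr (Lp_norm halfline p f) Q \<partial>lebesgue)"
    using borel_measurable_Lp_norm[OF f] I
    by (intro nn_integral_cmult borel_measurable_times_ennreal borel_measurable_indicator
        borel_measurable_epowr borel_measurable_const)
  finally show ?thesis
    unfolding igl_norm_def
    using epowr_mono[of "1 / Q"] epowr_cmult[of "M powr Q" _ "1 / Q"] M Q
    by (fastforce simp: powr_powr)
qed

text \<open>
  The interval \<open>(0, 1)\<close> has measure \<open>1\<close>, so the \<open>p\<close>-norms of its indicator agree for all \<open>p\<close>.
\<close>

lemma Lp_norm_step:
  assumes "0 < c" "p \<noteq> 0"
  shows "Lp_norm halfline p (\<lambda>t. c * indicator {0<..<1} t) = ennreal c"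
proof -
  have "(\<integral>\<^sup>+ t. ennreal (\<bar>c * indicator {0<..<1} t\<bar> powr p) \<partial>halfline)
      = (\<integral>\<^sup>+ t. ennreal (c powr p) * indicator {0<..<1::real} t \<partial>lebesgue)"
    using assms by (subst nn_integral_restrict_space)
      (auto intro!: nn_integral_cong simp: indicator_def)
  also have "\<dots> = ennreal (c powr p)"
    by (simp add: nn_integral_cmult_indicator)
  finally show ?thesis
    using assms by (simp add: Lp_norm_def epowr_def powr_powr)
qed

text \<open>
  With \<open>p\<close> and \<open>q\<close> close together this bounds dilation norms from below; with \<open>q \<rightarrow> \<infinity>\<close> it shows
  that the norm over \<open>[a, \<infinity>]\<close> is infinite for every function that is not null.
\<close>

lemma igl_norm_ge_on_subinterval:
  assumes Q: "0 < Q" and pq: "a \<le> p" "p \<le> q" "ereal q \<le> b" and m: "0 < m"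
    and ge: "\<And>r. p \<le> r \<Longrightarrow> r \<le> q \<Longrightarrow> ennreal m \<le> Lp_norm \<mu> r f"
  shows "ennreal (m * (q - p) powr (1 / Q)) \<le> igl_norm \<mu> lebesgue Q a b f"
proof -
  have "(\<integral>\<^sup>+ r. ennreal (m powr Q) * indicator {p..q} r \<partial>lebesgue)
      \<le> (\<integral>\<^sup>+ r\<in>{r. a \<le> r \<and> ereal r \<le> b}. epowr (Lp_norm \<mu> r f) Q \<partial>lebesgue)"
  proof (intro nn_integral_mono, goal_cases)
    case (1 r)
    have "ennreal (m powr Q) \<le> epowr (Lp_norm \<mu> r f) Q" if "p \<le> r" "r \<le> q"
      using epowr_mono[OF _ ge[OF that], of Q] Q m by (simp add: epowr_def)
    then show ?case
      using pq by (auto simp: indicator_def intro: order_trans[of "ereal r" "ereal q"])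
  qed
  also have "(\<integral>\<^sup>+ r. ennreal (m powr Q) * indicator {p..q} r \<partial>lebesgue) = ennreal (m powr Q * (q - p))"
    using pq by (simp add: nn_integral_cmult_indicator ennreal_mult)
  finally have "epowr (ennreal (m powr Q * (q - p))) (1 / Q) \<le> igl_norm \<mu> lebesgue Q a b f"
    unfolding igl_norm_def using Q by (intro epowr_mono) auto
  then show ?thesis
    using Q m pq by (simp add: epowr_def powr_mult powr_powr)
qed

lemma igl_norm_step:
  assumes Q: "0 < Q" and a: "0 < a" "a \<le> b" and c: "0 < c"
  shows "igl_norm halfline lebesgue Q a (ereal b) (\<lambda>t. c * indicator {0<..<1} t)
       = ennreal (c * (b - a) powr (1 / Q))"
proof -
  have "(\<integral>\<^sup>+ p\<in>{p. a \<le> p \<and> ereal p \<le> ereal b}.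
          epowr (Lp_norm halfline p (\<lambda>t. c * indicator {0<..<1} t)) Q \<partial>lebesgue)
      = (\<integral>\<^sup>+ p. ennreal (c powr Q) * indicator {a..b} p \<partial>lebesgue)"
    using a c by (intro nn_integral_cong) (auto split: split_indicator simp: Lp_norm_step epowr_def)
  also have "\<dots> = ennreal (c powr Q * (b - a))"
    using a by (simp add: nn_integral_cmult_indicator ennreal_mult)
  finally show ?thesis
    unfolding igl_norm_def using Q a c by (simp add: epowr_def powr_mult powr_powr)
qed

section \<open>An infinite range of exponents\<close>

text \<open>
  If \<open>|f| \<ge> c\<close> on a set of measure at least \<open>k\<close>, where \<open>0 < k \<le> 1\<close>, then
  \<open>|f|\<^sub>p \<ge> c k\<^bsup>1/p\<^esup> \<ge> c k\<close> for \<open>p \<ge> 1\<close>.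
\<close>

lemma Lp_norm_bounded_below:
  assumes f [measurable]: "f \<in> borel_measurable \<mu>"
    and pos: "emeasure \<mu> {t \<in> space \<mu>. f t \<noteq> 0} \<noteq> 0"
  obtains m where "0 < m" "\<And>p. 1 \<le> p \<Longrightarrow> ennreal m \<le> Lp_norm \<mu> p f"
proof -
  define E where "E n = {t \<in> space \<mu>. inverse (real (Suc n)) \<le> \<bar>f t\<bar>}" for n
  have E [measurable]: "E n \<in> sets \<mu>" for n
    unfolding E_def by measurable
  have "{t \<in> space \<mu>. f t \<noteq> 0} \<subseteq> (\<Union>n. E n)"
    unfolding E_def using reals_Archimedean[of "\<bar>f _\<bar>"] by (force intro: less_imp_le)
  then have "emeasure \<mu> {t \<in> space \<mu>. f t \<noteq> 0} \<le> emeasure \<mu> (\<Union>n. E n)"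
    by (intro emeasure_mono) auto
  with pos have "emeasure \<mu> (\<Union>n. E n) \<noteq> 0" by auto
  then obtain n where n: "emeasure \<mu> (E n) \<noteq> 0"
    using emeasure_UN_eq_0[of \<mu> E] E by blast
  define c where "c = inverse (real (Suc n))"
  have c: "0 < c" by (simp add: c_def)
  obtain k where k: "0 < k" "k \<le> 1" "ennreal k \<le> emeasure \<mu> (E n)"
  proof (cases "emeasure \<mu> (E n)")
    case (real r)
    then show ?thesis using n that[of "min 1 r"] by (auto simp: ennreal_leI)
  qed (use that[of 1] in auto)
  have "ennreal (c * k) \<le> Lp_norm \<mu> p f" if p: "1 \<le> p" for p
  proof -
    have "ennreal (c powr p * k) \<le> ennreal (c powr p) * emeasure \<mu> (E n)"
      using k c by (simp add: ennreal_mult mult_left_mono)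
    also have "\<dots> = (\<integral>\<^sup>+ t. ennreal (c powr p) * indicator (E n) t \<partial>\<mu>)"
      by (simp add: nn_integral_cmult_indicator)
    also have "\<dots> \<le> (\<integral>\<^sup>+ t. ennreal (\<bar>f t\<bar> powr p) \<partial>\<mu>)"
      using p c by (intro nn_integral_mono)
        (auto simp: indicator_def E_def c_def intro!: ennreal_leI powr_mono2)
    finally have "epowr (ennreal (c powr p * k)) (1 / p) \<le> Lp_norm \<mu> p f"
      unfolding Lp_norm_def using p by (intro epowr_mono) auto
    moreover have "epowr (ennreal (c powr p * k)) (1 / p) = ennreal (c * k powr (1 / p))"
      using c k p by (simp add: epowr_def powr_mult powr_powr)
    moreover have "k powr 1 \<le> k powr (1 / p)"
      using k p by (intro powr_mono') auto
    then have "ennreal (c * k) \<le> ennreal (c * k powr (1 / p))"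
      using c k by (intro ennreal_leI mult_left_mono) auto
    ultimately show ?thesis by simp
  qed
  then show thesis using that[of "c * k"] c k by auto
qed

text \<open>
  The \<open>p\<close>-norms of a function that is not null are bounded away from \<open>0\<close>, and the range of \<open>p\<close>
  has infinite length. The measure \<open>\<mu>\<close> is arbitrary because the hypothesis of the final theorem
  that the space is nonzero leaves the type of the underlying points open.
\<close>

lemma igl_norm_infinite_dichotomy:
  assumes f: "f \<in> borel_measurable \<mu>" and Q: "0 < Q" and a: "1 \<le> a"
  shows "igl_norm \<mu> lebesgue Q a \<infinity> f = 0 \<or> igl_norm \<mu> lebesgue Q a \<infinity> f = \<infinity>"
proof (cases "emeasure \<mu> {t \<in> space \<mu>. f t \<noteq> 0} = 0")
  case True
  have "(\<integral>\<^sup>+ t. ennreal (\<bar>f t\<bar> powr p) \<partial>\<mu>) = 0" for p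
  proof -
    have "(\<lambda>t. ennreal (\<bar>f t\<bar> powr p)) \<in> borel_measurable \<mu>"
      using f by measurable
    from nn_integral_0_iff[OF this] show ?thesis using True by simp
  qed
  then show ?thesis using Q by (simp add: igl_norm_def Lp_norm_def epowr_def)
next
  case False
  then obtain m where m: "0 < m" "\<And>p. 1 \<le> p \<Longrightarrow> ennreal m \<le> Lp_norm \<mu> p f"
    using Lp_norm_bounded_below[OF f] by blast
  have "ennreal r \<le> igl_norm \<mu> lebesgue Q a \<infinity> f" if r: "0 < r" for r
  proof -
    \<comment> \<open>An interval of length \<open>(r / m)\<^sup>Q\<close> in which all \<open>p\<close>-norms are at least \<open>m\<close> contributes \<open>r\<close>.\<close>
    have "ennreal (m * ((a + (r / m) powr Q) - a) powr (1 / Q)) \<le> igl_norm \<mu> lebesgue Q a \<infinity> f"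
      using m a Q by (intro igl_norm_ge_on_subinterval) auto
    then show ?thesis using m Q r by (simp add: powr_powr)
  qed
  then have "igl_norm \<mu> lebesgue Q a \<infinity> f = \<infinity>"
  proof (cases "igl_norm \<mu> lebesgue Q a \<infinity> f")
    case (real r)
    then show ?thesis using \<open>\<And>r. 0 < r \<Longrightarrow> ennreal r \<le> _\<close>[of "r + 1"] by simp
  qed simp
  then show ?thesis by simp
qed

section \<open>Two-sided bounds for the dilation norm\<close>

abbreviation (input) igl_dilation_norm :: "real \<Rightarrow> real \<Rightarrow> ereal \<Rightarrow> real \<Rightarrow> ennreal" where
  "igl_dilation_norm Q a b \<equiv>
     dilation_norm (igl_space halfline lebesgue Q a b) (igl_norm halfline lebesgue Q a b)"

lemma igl_dilation_norm_le:
  assumes "0 < s" "0 < Q" "0 < M"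
    and "\<And>p. a \<le> p \<Longrightarrow> ereal p \<le> b \<Longrightarrow> s powr (1 / p) \<le> M"
  shows "igl_dilation_norm Q a b s \<le> ennreal M"
  unfolding dilation_norm_def
proof (rule SUP_least)
  fix f assume f: "f \<in> {f \<in> igl_space halfline lebesgue Q a b. igl_norm halfline lebesgue Q a b f \<le> 1}"
  then have "igl_norm halfline lebesgue Q a b (dilation s f)
      \<le> ennreal M * igl_norm halfline lebesgue Q a b f"
    using assms by (intro igl_norm_dilation_le) (auto simp: igl_space_def)
  also have "\<dots> \<le> ennreal M * 1"
    using f by (intro mult_left_mono) auto
  finally show "igl_norm halfline lebesgue Q a b (dilation s f) \<le> ennreal M" by simp
qed

lemma igl_dilation_norm_ge:
  assumes s: "0 < s" and Q: "0 < Q" and a: "0 < a" and pq: "a \<le> p" "p < q" "q \<le> b" and m: "0 < m"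
    and ge: "\<And>r. p \<le> r \<Longrightarrow> r \<le> q \<Longrightarrow> m \<le> s powr (1 / r)"
  shows "ennreal (m * ((q - p) / (b - a)) powr (1 / Q)) \<le> igl_dilation_norm Q a (ereal b) s"
proof -
  \<comment> \<open>This makes the norm of the step function equal to \<open>1\<close>.\<close>
  define c where "c = 1 / (b - a) powr (1 / Q)"
  have c: "0 < c" using pq by (simp add: c_def)
  let ?f = "\<lambda>t. c * indicator {0<..<1} t :: real"
  have meas: "?f \<in> borel_measurable halfline"
    by (intro borel_measurable_times borel_measurable_const borel_measurable_indicator)
      (auto simp: sets_restrict_space_iff)
  have one: "igl_norm halfline lebesgue Q a (ereal b) ?f = 1"
    using igl_norm_step[OF Q a _ c, of b] pq by (simp add: c_def)
  have "ennreal (m * c) \<le> Lp_norm halfline r (dilation s ?f)" if "p \<le> r" "r \<le> q" for r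
  proof -
    have "Lp_norm halfline r (dilation s ?f) = ennreal (s powr (1 / r) * c)"
      using Lp_norm_dilation[OF meas s] Lp_norm_step[OF c, of r] that a pq c
      by (simp add: ennreal_mult)
    then show ?thesis
      using ge[OF that] c by (auto intro!: ennreal_leI mult_right_mono)
  qed
  then have "ennreal (m * c * (q - p) powr (1 / Q))
      \<le> igl_norm halfline lebesgue Q a (ereal b) (dilation s ?f)"
    using Q pq m c by (intro igl_norm_ge_on_subinterval) auto
  also have "\<dots> \<le> igl_dilation_norm Q a (ereal b) s"
    unfolding dilation_norm_def using meas one by (intro SUP_upper) (simp add: igl_space_def)
  also have "m * c * (q - p) powr (1 / Q) = m * ((q - p) / (b - a)) powr (1 / Q)"
    using pq by (simp add: c_def powr_divide)
  finally show ?thesis .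
qed

section \<open>The Boyd indices\<close>

text \<open>
  The limit \<open>x\<close> is the same for both bounds, so the sign of \<open>ln s\<close>, which decides which of the two
  quotients is the larger one, does not matter: the distance from one of them to the quotient in
  the middle is at most their distance from each other. Thus \<open>s \<rightarrow> \<infinity>\<close> and \<open>s \<rightarrow> 0\<close> are handled
  alike.
\<close>

lemma tendsto_elog_sandwich:
  assumes "\<forall>\<^sub>F s in F. ln s \<noteq> 0"
    and "\<forall>\<^sub>F s in F. 0 < l s \<and> ennreal (l s) \<le> D s \<and> D s \<le> ennreal (u s)"
    and "((\<lambda>s. ln (l s) / ln s) \<longlongrightarrow> x) F" "((\<lambda>s. ln (u s) / ln s) \<longlongrightarrow> x) F"
  shows "((\<lambda>s. elog (D s) / ereal (ln s)) \<longlongrightarrow> ereal x) F"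
proof -
  let ?d = "\<lambda>s. enn2real (D s)"
  have d: "\<forall>\<^sub>F s in F. D s = ennreal (?d s) \<and> 0 < l s \<and> l s \<le> ?d s \<and> ?d s \<le> u s"
    using assms(2)
  proof eventually_elim
    case (elim s)
    then have "D s < \<infinity>" by (auto intro: le_less_trans)
    then obtain r where r: "0 \<le> r" "D s = ennreal r"
      by (cases "D s") auto
    then show ?case
      using elim by (auto simp: ennreal_le_iff2)
  qed
  have "((\<lambda>s. ln (?d s) / ln s - ln (l s) / ln s) \<longlongrightarrow> 0) F"
  proof (rule Lim_null_comparison)
    show "\<forall>\<^sub>F s in F. norm (ln (?d s) / ln s - ln (l s) / ln s) \<le> \<bar>ln (u s) / ln s - ln (l s) / ln s\<bar>"
      using d
    proof eventually_elim
      case (elim s)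
      then have "ln (l s) \<le> ln (?d s)" "ln (?d s) \<le> ln (u s)" by auto
      then show ?case
        by (simp add: diff_divide_distrib[symmetric] abs_divide divide_right_mono)
    qed
    show "((\<lambda>s. \<bar>ln (u s) / ln s - ln (l s) / ln s\<bar>) \<longlongrightarrow> 0) F"
      using tendsto_rabs[OF tendsto_diff[OF assms(4,3)]] by simp
  qed
  from tendsto_add[OF this assms(3)] have "((\<lambda>s. ln (?d s) / ln s) \<longlongrightarrow> x) F" by simp
  then have "((\<lambda>s. ereal (ln (?d s) / ln s)) \<longlongrightarrow> ereal x) F" by simp
  then show ?thesis
  proof (rule Lim_transform_eventually)
    show "\<forall>\<^sub>F s in F. ereal (ln (?d s) / ln s) = elog (D s) / ereal (ln s)"
      using d assms(1)
    proof eventually_elim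
      case (elim s)
      then obtain r where "0 < r" "D s = ennreal r" by (metis less_le_trans)
      then show ?case using elim by (simp add: elog_def)
    qed
  qed
qed

text \<open>
  For \<open>s > 1\<close> the power \<open>s\<^bsup>1/r\<^esup>\<close> decreases in \<open>r\<close>, so exponents near \<open>a\<close> dominate. On
  \<open>[a, a + (b - a) / (1 + ln s)]\<close> the lower bound loses the factor \<open>(1 + ln s)\<^bsup>-1/Q\<^esup>\<close>, whose
  logarithm is negligible against \<open>ln s\<close>.
\<close>

lemma igl_upper_Boyd_index:
  assumes Q: "0 < Q" and a: "0 < a" "a < b"
  shows "has_upper_Boyd_index (igl_space halfline lebesgue Q a (ereal b))
           (igl_norm halfline lebesgue Q a (ereal b)) (ereal (1 / a))"
  unfolding has_upper_Boyd_index_def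
proof (rule tendsto_elog_sandwich)
  let ?q = "\<lambda>s. a + (b - a) / (1 + ln s)"
  let ?l = "\<lambda>s. s powr (1 / ?q s) * (1 / (1 + ln s)) powr (1 / Q)"
  show "\<forall>\<^sub>F s in at_top. ln s \<noteq> (0::real)"
    using eventually_gt_at_top[of 1] by eventually_elim simp
  show "\<forall>\<^sub>F s in at_top. 0 < ?l s \<and> ennreal (?l s) \<le> igl_dilation_norm Q a (ereal b) s
      \<and> igl_dilation_norm Q a (ereal b) s \<le> ennreal (s powr (1 / a))"
    using eventually_gt_at_top[of 1]
  proof eventually_elim
    case (elim s)
    then have ln: "0 < ln s" by simp
    have q: "a < ?q s" "?q s \<le> b" "?q s - a = (b - a) / (1 + ln s)"
      using a ln by (auto simp: field_simps)
    have "s powr (1 / ?q s) \<le> s powr (1 / r)" if "a \<le> r" "r \<le> ?q s" for r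
      using that elim a by (intro powr_mono divide_left_mono) auto
    then have "ennreal (s powr (1 / ?q s) * ((?q s - a) / (b - a)) powr (1 / Q))
        \<le> igl_dilation_norm Q a (ereal b) s"
      using elim Q a q by (intro igl_dilation_norm_ge) auto
    moreover have "(?q s - a) / (b - a) = 1 / (1 + ln s)"
      using a by simp
    moreover have "igl_dilation_norm Q a (ereal b) s \<le> ennreal (s powr (1 / a))"
      using elim Q a by (intro igl_dilation_norm_le powr_mono divide_left_mono) auto
    moreover have "1 + ln s \<noteq> 0"
      using ln by linarith
    ultimately show ?case
      using elim by simp
  qed
  show "((\<lambda>s. ln (?l s) / ln s) \<longlongrightarrow> 1 / a) at_top"
    using Q a by real_asymp (simp add: inverse_eq_divide)
  show "((\<lambda>s. ln (s powr (1 / a)) / ln s) \<longlongrightarrow> 1 / a) at_top"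
    using a by real_asymp
qed

text \<open>
  For \<open>s < 1\<close> the power \<open>s\<^bsup>1/r\<^esup>\<close> increases in \<open>r\<close>, so exponents near \<open>b\<close> dominate.
\<close>

lemma igl_lower_Boyd_index:
  assumes Q: "0 < Q" and a: "0 < a" "a < b"
  shows "has_lower_Boyd_index (igl_space halfline lebesgue Q a (ereal b))
           (igl_norm halfline lebesgue Q a (ereal b)) (ereal (1 / b))"
  unfolding has_lower_Boyd_index_def
proof (rule tendsto_elog_sandwich)
  let ?p = "\<lambda>s. b - (b - a) / (1 - ln s)"
  let ?l = "\<lambda>s. s powr (1 / ?p s) * (1 / (1 - ln s)) powr (1 / Q)"
  show "\<forall>\<^sub>F s in at_right 0. ln s \<noteq> (0::real)"
    using eventually_at_right_real[of 0 1, OF zero_less_one] by eventually_elim simp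
  show "\<forall>\<^sub>F s in at_right 0. 0 < ?l s \<and> ennreal (?l s) \<le> igl_dilation_norm Q a (ereal b) s
      \<and> igl_dilation_norm Q a (ereal b) s \<le> ennreal (s powr (1 / b))"
    using eventually_at_right_real[of 0 1, OF zero_less_one]
  proof eventually_elim
    case (elim s)
    then have s: "0 < s" "s < 1" and ln: "ln s < 0" by auto
    have "(b - a) / (1 - ln s) < (b - a) / 1"
      using a ln by (intro divide_strict_left_mono) auto
    then have p: "a \<le> ?p s" "?p s < b"
      using a ln by auto
    have "s powr (1 / ?p s) \<le> s powr (1 / r)" if "?p s \<le> r" "r \<le> b" for r
      using that s a p by (intro powr_mono' divide_left_mono) auto
    then have "ennreal (s powr (1 / ?p s) * ((b - ?p s) / (b - a)) powr (1 / Q))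
        \<le> igl_dilation_norm Q a (ereal b) s"
      using s Q a p by (intro igl_dilation_norm_ge) auto
    moreover have "(b - ?p s) / (b - a) = 1 / (1 - ln s)"
      using a by simp
    moreover have "igl_dilation_norm Q a (ereal b) s \<le> ennreal (s powr (1 / b))"
      using s Q a by (intro igl_dilation_norm_le powr_mono' divide_left_mono) auto
    moreover have "1 - ln s \<noteq> 0"
      using ln by linarith
    ultimately show ?case
      using s by simp
  qed
  show "((\<lambda>s. ln (?l s) / ln s) \<longlongrightarrow> 1 / b) (at_right 0)"
    using Q a by real_asymp (simp add: inverse_eq_divide)
  show "((\<lambda>s. ln (s powr (1 / b)) / ln s) \<longlongrightarrow> 1 / b) (at_right 0)"
    using a by real_asymp
qed

theorem theorem4p1:
  fixes a Q :: real and b :: ereal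
  assumes "1 \<le> Q" and "1 \<le> a" and "ereal a < b"
    and "nonzero_space (igl_space (lebesgue_on {0<..}) lebesgue Q a b)
           (igl_norm (lebesgue_on {0<..}) lebesgue Q a b)"
  shows "has_lower_Boyd_index (igl_space (lebesgue_on {0<..}) lebesgue Q a b)
           (igl_norm (lebesgue_on {0<..}) lebesgue Q a b) (1 / b)
       \<and> has_upper_Boyd_index (igl_space (lebesgue_on {0<..}) lebesgue Q a b)
           (igl_norm (lebesgue_on {0<..}) lebesgue Q a b) (1 / ereal a)"
proof (cases b)
  case (real r)
  then show ?thesis
    using igl_lower_Boyd_index[of Q a r] igl_upper_Boyd_index[of Q a r] assms
    by (simp add: one_ereal_def)
next
  case PInf
  then show ?thesis
    using assms igl_norm_infinite_dichotomy[of _ "lebesgue_on {0<..}" Q a]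
    by (fastforce simp: nonzero_space_def igl_space_def)
next
  case MInf
  then show ?thesis using assms by simp
qed

end
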